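(* If $f\in\mathbb{N}^{\mathbb{N}}$ is a $\Pi^0_1$-singleton, then $f$ strongly relativizes $\Delta^0_1$ at $\mathbb{N}^{\mathbb{N}}$.
   Context: For a finite sequence $\sigma\in\mathbb{N}^{<\mathbb{N}}$, $[\sigma]=\{h\in\mathbb{N}^{\mathbb{N}}:\sigma\sqsubset h\}$. A subset of $\mathbb{N}^{\mathbb{N}}$ (resp. of $\mathbb{N}^{\mathbb{N}}\times\mathbb{N}^{\mathbb{N}}$) is $\Sigma^0_1$ if it is the union of a c.e. family of basic open sets $[\sigma]$ (resp. $[\sigma]\times[\tau]$), $\Pi^0_1$ if its complement is $\Sigma^0_1$, and $\Delta^0_1$ if it is both. $f$ is a $\Pi^0_1$-singleton if $\{f\}$ is a $\Pi^0_1$ subset of $\mathbb{N}^{\mathbb{N}}$. For $Q\subseteq\mathbb{N}^{\mathbb{N}}\times\mathbb{N}^{\mathbb{N}}$, $Q_f=\{g:Q(f,g)\}$. A set $P\subseteq\mathbb{N}^{\mathbb{N}}$ is $\Delta^0_1(f)$ if both $P$ and its complement are $f$-sections of $\Sigma^0_1$ subsets of $\mathbb{N}^{\mathbb{N}}\times\mathbb{N}^{\mathbb{N}}$. $f$ strongly relativizes $\Delta^0_1$ at $\mathbb{N}^{\mathbb{N}}$ if every $\Delta^0_1(f)$ set $P\subseteq\mathbb{N}^{\mathbb{N}}$ equals $Q_f$ for some $\Delta^0_1$ set $Q\subseteq\mathbb{N}^{\mathbb{N}}\times\mathbb{N}^{\mathbb{N}}$. *)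

theory Defs
  imports Main "HOL-Library.Nat_Bijection"
begin

(* Programs for the partial recursive (mu-recursive) functions. Programs carry no arity;
   it is fixed by the length of the argument list on which they are run. *)
datatype recf =
    Zero
  | Succ
  | Proj nat
  | Comp recf "recf list"
  | PrimRec recf recf
  | Mu recf

(* "evaluates p xs y": the computation of p on the arguments xs converges with value y.
   Primitive recursion is on the first argument, and minimization searches over it; the search
   requires all earlier values to converge. *)
inductive evaluates :: "recf \<Rightarrow> nat list \<Rightarrow> nat \<Rightarrow> bool" where
  eval_Zero: "evaluates Zero xs 0"
| eval_Succ: "evaluates Succ [x] (Suc x)"
| eval_Proj: "i < length xs \<Longrightarrow> evaluates (Proj i) xs (xs ! i)"
| eval_Comp: "list_all2 (\<lambda>q y. evaluates q xs y) qs ys \<Longrightarrow> evaluates p ys z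
    \<Longrightarrow> evaluates (Comp p qs) xs z"
| eval_PrimRec_0: "evaluates p xs y \<Longrightarrow> evaluates (PrimRec p q) (0 # xs) y"
| eval_PrimRec_Suc: "evaluates (PrimRec p q) (n # xs) y \<Longrightarrow> evaluates q (n # y # xs) z
    \<Longrightarrow> evaluates (PrimRec p q) (Suc n # xs) z"
| eval_Mu: "evaluates p (n # xs) 0 \<Longrightarrow> (\<forall>m<n. \<exists>y. evaluates p (m # xs) (Suc y))
    \<Longrightarrow> evaluates (Mu p) xs n"

lemma evaluates_deterministic:
  "evaluates p xs y \<Longrightarrow> evaluates p xs z \<Longrightarrow> z = y"
proof (induction arbitrary: z rule: evaluates.induct)
  case (eval_Comp xs qs ys p w)
  from eval_Comp.prems obtain zs where zs: "list_all2 (\<lambda>q y. evaluates q xs y) qs zs"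
    and z: "evaluates p zs z" by cases auto
  have "zs = ys"
    using eval_Comp.IH(1) zs by (auto simp: list_all2_conv_all_nth intro!: nth_equalityI)
  with z eval_Comp.IH(2) show ?case by simp
next
  case (eval_PrimRec_0 p xs y q)
  from eval_PrimRec_0.prems eval_PrimRec_0.IH show ?case by cases auto
next
  case (eval_PrimRec_Suc p q n xs y w)
  from eval_PrimRec_Suc.prems eval_PrimRec_Suc.IH show ?case by cases auto
next
  case (eval_Mu p n xs)
  from eval_Mu.prems obtain z0: "evaluates p (z # xs) 0"
    and zs: "\<forall>m<z. \<exists>y. evaluates p (m # xs) (Suc y)" by cases auto
  have "\<not> n < z" using zs eval_Mu.IH(1) by fastforce
  moreover have "\<not> z < n" using z0 eval_Mu.IH(2) by fastforce
  ultimately show ?case by simp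
qed (auto elim: evaluates.cases)

definition computable :: "(nat \<Rightarrow> nat) \<Rightarrow> bool" where
  "computable h \<longleftrightarrow> (\<exists>p. \<forall>x. evaluates p [x] (h x))"

definition ce :: "nat set \<Rightarrow> bool" where
  "ce A \<longleftrightarrow> A = {} \<or> (\<exists>h. computable h \<and> A = range h)"

definition code_pair :: "nat list \<times> nat list \<Rightarrow> nat" where
  "code_pair = (\<lambda>(\<sigma>, \<tau>). prod_encode (list_encode \<sigma>, list_encode \<tau>))"

type_synonym baire = "nat \<Rightarrow> nat"

definition cylinder :: "nat list \<Rightarrow> baire set" where
  "cylinder \<sigma> = {h. \<forall>i<length \<sigma>. h i = \<sigma> ! i}"

definition Sigma01 :: "baire set \<Rightarrow> bool" where
  "Sigma01 S \<longleftrightarrow> (\<exists>A. ce (list_encode ` A) \<and> S = (\<Union>\<sigma>\<in>A. cylinder \<sigma>))"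

definition Pi01 :: "baire set \<Rightarrow> bool" where
  "Pi01 S \<longleftrightarrow> Sigma01 (- S)"

definition Sigma01_2 :: "(baire \<times> baire) set \<Rightarrow> bool" where
  "Sigma01_2 S \<longleftrightarrow>
    (\<exists>A. ce (code_pair ` A) \<and> S = (\<Union>(\<sigma>, \<tau>)\<in>A. cylinder \<sigma> \<times> cylinder \<tau>))"

definition Pi01_2 :: "(baire \<times> baire) set \<Rightarrow> bool" where
  "Pi01_2 S \<longleftrightarrow> Sigma01_2 (- S)"

definition Delta01_2 :: "(baire \<times> baire) set \<Rightarrow> bool" where
  "Delta01_2 S \<longleftrightarrow> Sigma01_2 S \<and> Pi01_2 S"

definition Pi01_singleton :: "baire \<Rightarrow> bool" where
  "Pi01_singleton f \<longleftrightarrow> Pi01 {f}"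

definition fsection :: "(baire \<times> baire) set \<Rightarrow> baire \<Rightarrow> baire set" where
  "fsection Q f = {g. (f, g) \<in> Q}"

definition Delta01_in :: "baire \<Rightarrow> baire set \<Rightarrow> bool" where
  "Delta01_in f P \<longleftrightarrow>
    (\<exists>U. Sigma01_2 U \<and> P = fsection U f) \<and> (\<exists>V. Sigma01_2 V \<and> - P = fsection V f)"

definition strongly_relativizes_Delta01 :: "baire \<Rightarrow> bool" where
  "strongly_relativizes_Delta01 f \<longleftrightarrow>
    (\<forall>P. Delta01_in f P \<longrightarrow> (\<exists>Q. Delta01_2 Q \<and> P = fsection Q f))"

end

theory Submission
  imports Defs Complex_Main
begin

text \<open>Let \<open>P\<close> be the section at \<open>f\<close> of \<open>U\<close> and its complement that of \<open>V\<close>, and let \<open>W\<close> be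
  the complement of \<open>{f}\<close>. The open sets \<open>U\<close> and \<open>V \<union> W \<times> UNIV\<close> cover the plane, and
  their sections at \<open>f\<close> are disjoint. The reduction property of \<open>\<Sigma>\<^sup>0\<^sub>1\<close> shrinks them to
  complementary sets, deciding membership of a point by which of the two enumerations captures
  it first; at \<open>f\<close> nothing is lost, as the sections were disjoint already.\<close>

section \<open>Closure properties of recursive functions\<close>

text \<open>Functions of argument lists keep the closure properties uniform in the arity; only lists
  of length \<open>n\<close> matter, since programs carry no arity of their own.\<close>

definition recursive :: "nat \<Rightarrow> (nat list \<Rightarrow> nat) \<Rightarrow> bool" where
  "recursive n F \<longleftrightarrow> (\<exists>p. \<forall>xs. length xs = n \<longrightarrow> evaluates p xs (F xs))"

definition decidable :: "nat \<Rightarrow> (nat list \<Rightarrow> bool) \<Rightarrow> bool" where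
  "decidable n P \<longleftrightarrow> recursive n (\<lambda>xs. of_bool (P xs))"

lemma recursive_cong:
  assumes "recursive n F" "\<And>xs. length xs = n \<Longrightarrow> F xs = G xs"
  shows "recursive n G"
  using assms unfolding recursive_def by metis

lemma computable_iff_recursive: "computable h \<longleftrightarrow> recursive 1 (\<lambda>xs. h (xs ! 0))"
proof
  assume "computable h"
  then obtain p where "\<forall>x. evaluates p [x] (h x)" unfolding computable_def ..
  then show "recursive 1 (\<lambda>xs. h (xs ! 0))"
    unfolding recursive_def by (intro exI[of _ p]) (auto simp: length_Suc_conv)
next
  assume "recursive 1 (\<lambda>xs. h (xs ! 0))"
  then obtain p where p: "\<forall>xs. length xs = 1 \<longrightarrow> evaluates p xs (h (xs ! 0))"
    unfolding recursive_def ..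
  have "evaluates p [x] (h x)" for x using p[rule_format, of "[x]"] by simp
  then show "computable h" unfolding computable_def by blast
qed

named_theorems recursive_intros

lemma recursive_nth [recursive_intros]: "i < n \<Longrightarrow> recursive n (\<lambda>xs. xs ! i)"
  unfolding recursive_def by (auto intro: eval_Proj)

section \<open>Composition, primitive recursion and minimization\<close>

lemma recursive_comp:
  assumes "recursive (length Fs) G" and "\<And>F. F \<in> set Fs \<Longrightarrow> recursive n F"
  shows "recursive n (\<lambda>xs. G (map (\<lambda>F. F xs) Fs))"
proof -
  obtain p where p: "\<And>ys. length ys = length Fs \<Longrightarrow> evaluates p ys (G ys)"
    using assms(1) unfolding recursive_def by blast
  obtain q where q: "\<And>F xs. F \<in> set Fs \<Longrightarrow> length xs = n \<Longrightarrow> evaluates (q F) xs (F xs)"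
    using assms(2) unfolding recursive_def by metis
  have "evaluates (Comp p (map q Fs)) xs (G (map (\<lambda>F. F xs) Fs))" if "length xs = n" for xs
    by (rule eval_Comp[where ys = "map (\<lambda>F. F xs) Fs"])
      (auto simp: list_all2_conv_all_nth p q that)
  then show ?thesis unfolding recursive_def by blast
qed

lemma recursive_comp1:
  assumes "computable g" "recursive n F"
  shows "recursive n (\<lambda>xs. g (F xs))"
  using recursive_comp[of "[F]" "\<lambda>xs. g (xs ! 0)" n] assms
  by (simp add: computable_iff_recursive)

lemma recursive_comp2:
  assumes "recursive 2 (\<lambda>xs. g (xs ! 0) (xs ! 1))" "recursive n F" "recursive n G"
  shows "recursive n (\<lambda>xs. g (F xs) (G xs))"
  using recursive_comp[of "[F, G]" "\<lambda>xs. g (xs ! 0) (xs ! 1)" n] assms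
  by (auto simp: numeral_2_eq_2)

lemma recursive_Suc [recursive_intros]:
  assumes "recursive n F"
  shows "recursive n (\<lambda>xs. Suc (F xs))"
proof (rule recursive_comp1[OF _ assms])
  show "computable Suc" unfolding computable_def by (blast intro: eval_Succ)
qed

lemma recursive_const [recursive_intros]: "recursive n (\<lambda>xs. c)"
proof (induction c)
  case 0
  show ?case unfolding recursive_def by (blast intro: eval_Zero)
next
  case (Suc c)
  then show ?case by (rule recursive_Suc)
qed

text \<open>Lets a function of counter and parameters serve in a recursion step, where the previous
  value sits between them at position 1.\<close>

lemma recursive_drop_args:
  assumes "recursive (Suc n) F"
  shows "recursive (Suc (Suc n)) (\<lambda>xs. F (xs ! 0 # drop 2 xs))"
proof -
  let ?Fs = "(\<lambda>xs. xs ! 0) # map (\<lambda>i xs. xs ! (i + 2)) [0..<n]"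
  have "recursive (Suc (Suc n)) (\<lambda>xs. F (map (\<lambda>G. G xs) ?Fs))"
    by (rule recursive_comp) (use assms in \<open>auto intro!: recursive_intros\<close>)
  then show ?thesis
  proof (rule recursive_cong)
    fix xs :: "nat list"
    assume "length xs = Suc (Suc n)"
    then have "map (\<lambda>G. G xs) ?Fs = xs ! 0 # drop 2 xs"
      by (auto intro!: nth_equalityI simp: nth_Cons split: nat.splits)
    then show "F (map (\<lambda>G. G xs) ?Fs) = F (xs ! 0 # drop 2 xs)" by simp
  qed
qed

lemma recursive_rec_nat:
  assumes F: "recursive n F" and G: "recursive (Suc (Suc n)) G" and K: "recursive n K"
  shows "recursive n (\<lambda>xs. rec_nat (F xs) (\<lambda>k y. G (k # y # xs)) (K xs))"
proof -
  obtain p where p: "\<And>xs. length xs = n \<Longrightarrow> evaluates p xs (F xs)"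
    using F unfolding recursive_def by blast
  obtain q where q: "\<And>xs. length xs = Suc (Suc n) \<Longrightarrow> evaluates q xs (G xs)"
    using G unfolding recursive_def by blast
  let ?R = "\<lambda>xs. rec_nat (F xs) (\<lambda>k y. G (k # y # xs))"
  have "evaluates (PrimRec p q) (k # xs) (?R xs k)" if "length xs = n" for k xs
    by (induction k) (auto intro!: eval_PrimRec_0 p that intro: eval_PrimRec_Suc[OF _ q] simp: that)
  then have "evaluates (PrimRec p q) zs (?R (tl zs) (hd zs))" if "length zs = Suc n" for zs
    using that by (cases zs) auto
  then have R: "recursive (Suc n) (\<lambda>zs. ?R (tl zs) (hd zs))"
    unfolding recursive_def by blast
  \<comment> \<open>The program recurses on its first argument; prepending \<open>K\<close> to the
    projections supplies the depth \<open>K xs\<close> and leaves the parameters \<open>xs\<close>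
    intact.\<close>
  let ?Fs = "K # map (\<lambda>i xs. xs ! i) [0..<n]"
  have "recursive n (\<lambda>xs. (\<lambda>zs. ?R (tl zs) (hd zs)) (map (\<lambda>H. H xs) ?Fs))"
    by (rule recursive_comp) (use R K in \<open>auto intro!: recursive_intros\<close>)
  then show ?thesis
  proof (rule recursive_cong)
    fix xs :: "nat list"
    assume "length xs = n"
    then have "map (\<lambda>H. H xs) ?Fs = K xs # xs"
      by (simp add: comp_def) (metis map_nth)
    then show "(\<lambda>zs. ?R (tl zs) (hd zs)) (map (\<lambda>H. H xs) ?Fs) = ?R xs (K xs)" by simp
  qed
qed

text \<open>Since \<open>F\<close> is total, every failed test before the least zero converges to a
  positive value, as the rule for \<open>Mu\<close> demands.\<close>

lemma recursive_Least:
  assumes F: "recursive (Suc n) F" and ex: "\<And>xs. \<exists>k. F (k # xs) = 0"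
  shows "recursive n (\<lambda>xs. LEAST k. F (k # xs) = 0)"
proof -
  obtain p where p: "\<And>xs. length xs = Suc n \<Longrightarrow> evaluates p xs (F xs)"
    using F unfolding recursive_def by blast
  have "evaluates (Mu p) xs (LEAST k. F (k # xs) = 0)" if len: "length xs = n" for xs
  proof (rule eval_Mu)
    have "F ((LEAST k. F (k # xs) = 0) # xs) = 0" using ex by (rule LeastI_ex)
    then show "evaluates p ((LEAST k. F (k # xs) = 0) # xs) 0"
      using p[of "(LEAST k. F (k # xs) = 0) # xs"] len by simp
    show "\<forall>m<LEAST k. F (k # xs) = 0. \<exists>y. evaluates p (m # xs) (Suc y)"
    proof (intro allI impI)
      fix m assume "m < (LEAST k. F (k # xs) = 0)"
      then have "F (m # xs) \<noteq> 0" by (rule not_less_Least)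
      then obtain y where "F (m # xs) = Suc y" by (cases "F (m # xs)") auto
      then show "\<exists>y. evaluates p (m # xs) (Suc y)" using p[of "m # xs"] len by auto
    qed
  qed
  then show ?thesis unfolding recursive_def by blast
qed

section \<open>Arithmetic functions\<close>

lemma recursive_add [recursive_intros]:
  assumes "recursive n F" "recursive n G"
  shows "recursive n (\<lambda>xs. F xs + G xs)"
proof -
  \<comment> \<open>Position 0 holds the counter, 1 the previous value, and the parameters start at
    2. The unreduced application matches the \<open>G\<close> of
    \<open>recursive_rec_nat\<close>.\<close>
  have "recursive n (\<lambda>xs. rec_nat (F xs) (\<lambda>k y. (\<lambda>zs. Suc (zs ! 1)) (k # y # xs)) (G xs))"
    by (rule recursive_rec_nat) (auto intro!: recursive_intros assms)
  moreover have "rec_nat a (\<lambda>k. Suc) b = a + b" for a b by (induction b) auto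
  ultimately show ?thesis by simp
qed

lemma recursive_mult [recursive_intros]:
  assumes "recursive n F" "recursive n G"
  shows "recursive n (\<lambda>xs. F xs * G xs)"
proof (rule recursive_comp2[OF _ assms])
  have "recursive 2 (\<lambda>xs. rec_nat 0 (\<lambda>k y. (\<lambda>zs. zs ! 1 + zs ! 2) (k # y # xs)) (xs ! 1))"
    by (rule recursive_rec_nat) (auto intro!: recursive_intros)
  moreover have "rec_nat 0 (\<lambda>k y. y + a) b = a * b" for a b :: nat by (induction b) auto
  ultimately show "recursive 2 (\<lambda>xs. xs ! 0 * xs ! 1)" by simp
qed

lemma recursive_pred [recursive_intros]:
  assumes "recursive n F"
  shows "recursive n (\<lambda>xs. F xs - 1)"
proof -
  have "recursive n (\<lambda>xs. rec_nat 0 (\<lambda>k y. (\<lambda>zs. zs ! 0) (k # y # xs)) (F xs))"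
    by (rule recursive_rec_nat) (auto intro!: recursive_intros assms)
  moreover have "rec_nat 0 (\<lambda>k y. k) b = b - 1" for b by (cases b) auto
  ultimately show ?thesis by simp
qed

lemma recursive_diff [recursive_intros]:
  assumes "recursive n F" "recursive n G"
  shows "recursive n (\<lambda>xs. F xs - G xs)"
proof -
  have "recursive n (\<lambda>xs. rec_nat (F xs) (\<lambda>k y. (\<lambda>zs. zs ! 1 - 1) (k # y # xs)) (G xs))"
    by (rule recursive_rec_nat) (auto intro!: recursive_intros assms simp del: One_nat_def)
  moreover have "rec_nat a (\<lambda>k y. y - Suc 0) b = a - b" for a b by (induction b) auto
  ultimately show ?thesis by simp
qed

section \<open>Boolean operations, equality, case distinction and bounded quantification\<close>

lemma decidable_not [recursive_intros]:
  assumes "decidable n P"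
  shows "decidable n (\<lambda>xs. \<not> P xs)"
proof -
  have "recursive n (\<lambda>xs. 1 - of_bool (P xs))"
    using assms unfolding decidable_def by (intro recursive_intros)
  then show ?thesis unfolding decidable_def by (rule recursive_cong) auto
qed

lemma decidable_conj [recursive_intros]:
  assumes "decidable n P" "decidable n Q"
  shows "decidable n (\<lambda>xs. P xs \<and> Q xs)"
proof -
  have "recursive n (\<lambda>xs. of_bool (P xs) * of_bool (Q xs))"
    using assms unfolding decidable_def by (intro recursive_intros)
  then show ?thesis unfolding decidable_def by (rule recursive_cong) auto
qed

lemma decidable_disj [recursive_intros]:
  assumes "decidable n P" "decidable n Q"
  shows "decidable n (\<lambda>xs. P xs \<or> Q xs)"
proof -
  have "decidable n (\<lambda>xs. \<not> (\<not> P xs \<and> \<not> Q xs))" by (intro recursive_intros assms)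
  then show ?thesis by simp
qed

lemma decidable_eq [recursive_intros]:
  assumes "recursive n F" "recursive n G"
  shows "decidable n (\<lambda>xs. F xs = G xs)"
proof -
  have "recursive n (\<lambda>xs. 1 - ((F xs - G xs) + (G xs - F xs)))"
    by (intro recursive_intros assms)
  then show ?thesis unfolding decidable_def by (rule recursive_cong) auto
qed

lemma recursive_if [recursive_intros]:
  assumes "decidable n P" "recursive n F" "recursive n G"
  shows "recursive n (\<lambda>xs. if P xs then F xs else G xs)"
proof -
  have "recursive n (\<lambda>xs. of_bool (P xs) * F xs + (1 - of_bool (P xs)) * G xs)"
    using assms unfolding decidable_def by (intro recursive_intros)
  then show ?thesis by (rule recursive_cong) auto
qed

lemma decidable_comp2:
  assumes "decidable 2 (\<lambda>xs. P (xs ! 0) (xs ! 1))" "recursive n F" "recursive n G"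
  shows "decidable n (\<lambda>xs. P (F xs) (G xs))"
  using assms unfolding decidable_def by (rule recursive_comp2)

lemma decidable_all_less:
  assumes P: "decidable (Suc n) P" and K: "recursive n K"
  shows "decidable n (\<lambda>xs. \<forall>m<K xs. P (m # xs))"
proof -
  \<comment> \<open>The quantifier is computed as a running product of truth values, starting from
    1.\<close>
  let ?G = "\<lambda>zs. zs ! 1 * of_bool (P (zs ! 0 # drop 2 zs))"
  have "recursive n (\<lambda>xs. rec_nat 1 (\<lambda>k y. ?G (k # y # xs)) (K xs))"
    by (rule recursive_rec_nat[OF _ _ K])
      (use P in \<open>auto intro!: recursive_intros recursive_drop_args simp: decidable_def\<close>)
  moreover have "rec_nat 1 (\<lambda>k y. ?G (k # y # xs)) b = of_bool (\<forall>m<b. P (m # xs))" for b xs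
    by (induction b) (auto simp: less_Suc_eq)
  ultimately show ?thesis unfolding decidable_def by simp
qed

section \<open>Recursiveness of the codings of pairs and lists\<close>

lemma recursive_triangle [recursive_intros]:
  assumes "recursive n F"
  shows "recursive n (\<lambda>xs. triangle (F xs))"
proof -
  have "recursive n (\<lambda>xs. rec_nat 0 (\<lambda>k y. (\<lambda>zs. zs ! 1 + Suc (zs ! 0)) (k # y # xs)) (F xs))"
    by (rule recursive_rec_nat) (auto intro!: recursive_intros assms)
  moreover have "rec_nat 0 (\<lambda>k y. y + Suc k) b = triangle b" for b by (induction b) auto
  ultimately show ?thesis by simp
qed

lemma recursive_prod_encode [recursive_intros]:
  assumes "recursive n F" "recursive n G"
  shows "recursive n (\<lambda>xs. prod_encode (F xs, G xs))"
  using assms by (simp add: prod_encode_def recursive_intros)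

lemma triangle_mono: "i \<le> j \<Longrightarrow> triangle i \<le> triangle j"
  by (induction rule: dec_induct) auto

text \<open>The index of the Cantor diagonal containing \<open>z\<close>: the least \<open>s\<close>
  with \<open>z < triangle (Suc s)\<close>, phrased as a vanishing truncated difference to fit
  \<open>recursive_Least\<close>.\<close>

definition diagonal :: "nat \<Rightarrow> nat" where
  "diagonal z = (LEAST s. Suc z - triangle (Suc s) = 0)"

text \<open>The code is \<open>triangle (a + b) + a\<close> with \<open>a \<le> a + b\<close>, so it
  lies below \<open>triangle (Suc (a + b))\<close> but not below
  \<open>triangle (a + b)\<close>.\<close>

lemma diagonal_prod_encode: "diagonal (prod_encode (a, b)) = a + b"
  unfolding diagonal_def prod_encode_def
proof (rule Least_equality)
  fix s
  assume *: "Suc ((case (a, b) of (m, n) \<Rightarrow> triangle (m + n) + m)) - triangle (Suc s) = 0"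
  show "a + b \<le> s"
  proof (rule ccontr)
    assume "\<not> a + b \<le> s"
    then show False using triangle_mono[of "Suc s" "a + b"] * by simp
  qed
qed simp

text \<open>Replaces decoding by an explicit formula: once the diagonal is known, subtraction
  recovers both components.\<close>

lemma prod_decode_diagonal:
  "fst (prod_decode z) = z - triangle (diagonal z)"
  "snd (prod_decode z) = diagonal z - fst (prod_decode z)"
proof -
  obtain a b where ab: "prod_decode z = (a, b)" by force
  then have z: "z = prod_encode (a, b)" by (metis prod_decode_inverse)
  show "fst (prod_decode z) = z - triangle (diagonal z)"
    "snd (prod_decode z) = diagonal z - fst (prod_decode z)"
    unfolding z diagonal_prod_encode prod_encode_inverse by (simp_all add: prod_encode_def)
qed

lemma recursive_diagonal [recursive_intros]:
  assumes "recursive n F"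
  shows "recursive n (\<lambda>xs. diagonal (F xs))"
proof (rule recursive_comp1[OF _ assms])
  \<comment> \<open>As \<open>triangle\<close> dominates the identity, the search for the diagonal
    of \<open>z\<close> succeeds at \<open>z\<close> at the latest.\<close>
  have large: "s \<le> triangle s" for s by (induction s) auto
  have "recursive 1 (\<lambda>xs. LEAST s. (\<lambda>zs. Suc (zs ! 1) - triangle (Suc (zs ! 0))) (s # xs) = 0)"
  proof (rule recursive_Least)
    show "recursive (Suc 1) (\<lambda>zs. Suc (zs ! 1) - triangle (Suc (zs ! 0)))"
      by (intro recursive_intros) auto
    show "\<exists>s. Suc ((s # xs) ! 1) - triangle (Suc ((s # xs) ! 0)) = 0" for xs
      using large[of "Suc (xs ! 0)"] by (intro exI[of _ "xs ! 0"]) simp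
  qed
  then show "computable diagonal"
    by (simp add: computable_iff_recursive diagonal_def)
qed

lemma recursive_fst_prod_decode [recursive_intros]:
  "recursive n F \<Longrightarrow> recursive n (\<lambda>xs. fst (prod_decode (F xs)))"
  unfolding prod_decode_diagonal by (intro recursive_intros)

lemma recursive_snd_prod_decode [recursive_intros]:
  "recursive n F \<Longrightarrow> recursive n (\<lambda>xs. snd (prod_decode (F xs)))"
  unfolding prod_decode_diagonal(2) by (intro recursive_intros)

text \<open>A nonempty list is coded by the successor of the pair of its head and the code of its
  tail, so each step strips one head.\<close>

definition drop_code :: "nat \<Rightarrow> nat \<Rightarrow> nat" where
  "drop_code i s = rec_nat s (\<lambda>_ y. snd (prod_decode (y - 1))) i"

text \<open>Shifted by one, so that \<open>0\<close> signals an index beyond the end of the list.\<close>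

definition item :: "nat \<Rightarrow> nat \<Rightarrow> nat" where
  "item i s = (if drop_code i s = 0 then 0 else Suc (fst (prod_decode (drop_code i s - 1))))"

lemma drop_code_list_encode: "drop_code i (list_encode \<sigma>) = list_encode (drop i \<sigma>)"
proof (induction i)
  case 0
  show ?case by (simp add: drop_code_def)
next
  case (Suc i)
  \<comment> \<open>Makes the empty list, with code 0, a fixed point of stripping, in agreement with
    \<open>tl [] = []\<close>.\<close>
  have "prod_decode 0 = (0, 0)" by (simp add: prod_decode_def prod_decode_aux.simps)
  then have "snd (prod_decode (list_encode \<rho> - 1)) = list_encode (tl \<rho>)" for \<rho>
    by (cases \<rho>) auto
  with Suc show ?case by (simp add: drop_code_def drop_Suc tl_drop)
qed

lemma item_list_encode: "item i (list_encode \<sigma>) = (if i < length \<sigma> then Suc (\<sigma> ! i) else 0)"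
proof (cases "i < length \<sigma>")
  case True
  then have "drop i \<sigma> = \<sigma> ! i # drop (Suc i) \<sigma>" by (rule Cons_nth_drop_Suc[symmetric])
  with True show ?thesis by (simp add: item_def drop_code_list_encode)
qed (simp add: item_def drop_code_list_encode)

lemma recursive_item [recursive_intros]:
  assumes "recursive n F" "recursive n G"
  shows "recursive n (\<lambda>xs. item (F xs) (G xs))"
proof -
  have "recursive n
      (\<lambda>xs. rec_nat (G xs) (\<lambda>k y. (\<lambda>zs. snd (prod_decode (zs ! 1 - 1))) (k # y # xs)) (F xs))"
    by (rule recursive_rec_nat) (auto intro!: recursive_intros assms simp del: One_nat_def)
  then have "recursive n (\<lambda>xs. drop_code (F xs) (G xs))" by (simp add: drop_code_def)
  then show ?thesis unfolding item_def by (intro recursive_intros)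
qed

text \<open>Allows quantifiers over list positions to be bounded by the code itself.\<close>

lemma length_le_list_encode: "length \<sigma> \<le> list_encode \<sigma>"
proof (induction \<sigma>)
  case (Cons x \<sigma>)
  then show ?case using le_prod_encode_2[of "list_encode \<sigma>" x] by simp
qed simp

section \<open>Comparing coded boxes\<close>

text \<open>Positions past the end of the first list have item 0 and impose nothing; at the others,
  equality also forces the position to exist in the second list.\<close>

definition prefix_code :: "nat \<Rightarrow> nat \<Rightarrow> bool" where
  "prefix_code u s \<longleftrightarrow> (\<forall>i<u. item i u = 0 \<or> item i u = item i s)"

text \<open>Incompatibility, which is stronger than not being a prefix. The negated universal form
  fits \<open>decidable_all_less\<close>.\<close>

definition clash_code :: "nat \<Rightarrow> nat \<Rightarrow> bool" where
  "clash_code u s \<longleftrightarrow> \<not> (\<forall>i<u. item i u = 0 \<or> item i s = 0 \<or> item i u = item i s)"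

lemma prefix_code_list_encode:
  "prefix_code (list_encode \<sigma>) (list_encode \<rho>) \<longleftrightarrow>
    (\<forall>i<length \<sigma>. i < length \<rho> \<and> \<sigma> ! i = \<rho> ! i)"
  using length_le_list_encode[of \<sigma>]
  by (auto simp: prefix_code_def item_list_encode split: if_splits)

lemma clash_code_list_encode:
  "clash_code (list_encode \<sigma>) (list_encode \<rho>) \<longleftrightarrow>
    (\<exists>i<length \<sigma>. i < length \<rho> \<and> \<sigma> ! i \<noteq> \<rho> ! i)"
  using length_le_list_encode[of \<sigma>]
  by (auto simp: clash_code_def item_list_encode split: if_splits)

lemma decidable_prefix_code [recursive_intros]:
  assumes "recursive n F" "recursive n G"
  shows "decidable n (\<lambda>xs. prefix_code (F xs) (G xs))"
proof (rule decidable_comp2[OF _ assms])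
  have "decidable 2 (\<lambda>xs. \<forall>i<xs ! 0.
      (\<lambda>zs. item (zs ! 0) (zs ! 1) = 0 \<or> item (zs ! 0) (zs ! 1) = item (zs ! 0) (zs ! 2)) (i # xs))"
    by (rule decidable_all_less; intro recursive_intros) auto
  then show "decidable 2 (\<lambda>xs. prefix_code (xs ! 0) (xs ! 1))" by (simp add: prefix_code_def)
qed

lemma decidable_clash_code [recursive_intros]:
  assumes "recursive n F" "recursive n G"
  shows "decidable n (\<lambda>xs. clash_code (F xs) (G xs))"
proof (rule decidable_comp2[OF _ assms])
  have "decidable 2 (\<lambda>xs. \<not> (\<forall>i<xs ! 0.
      (\<lambda>zs. item (zs ! 0) (zs ! 1) = 0 \<or> item (zs ! 0) (zs ! 2) = 0 \<or>
        item (zs ! 0) (zs ! 1) = item (zs ! 0) (zs ! 2)) (i # xs)))"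
    by (rule decidable_not, rule decidable_all_less; intro recursive_intros) auto
  then show "decidable 2 (\<lambda>xs. clash_code (xs ! 0) (xs ! 1))" by (simp add: clash_code_def)
qed

lemma cylinder_prefix_code:
  "prefix_code (list_encode \<sigma>) (list_encode \<rho>) \<Longrightarrow> cylinder \<rho> \<subseteq> cylinder \<sigma>"
  by (auto simp: prefix_code_list_encode cylinder_def)

lemma cylinder_clash_code:
  "clash_code (list_encode \<sigma>) (list_encode \<rho>) \<Longrightarrow> cylinder \<sigma> \<inter> cylinder \<rho> = {}"
  by (auto simp: clash_code_list_encode cylinder_def)

abbreviation initial :: "baire \<Rightarrow> nat \<Rightarrow> nat list" where
  "initial x N \<equiv> map x [0..<N]"

text \<open>Claimed for all large \<open>N\<close>, not just some, so that finitely many such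
  conditions can be met by a common \<open>N\<close>.\<close>

lemma eventually_prefix_code:
  "x \<in> cylinder \<sigma> \<Longrightarrow>
    eventually (\<lambda>N. prefix_code (list_encode \<sigma>) (list_encode (initial x N))) sequentially"
  by (rule eventually_mono[OF eventually_ge_at_top[of "length \<sigma>"]])
    (auto simp: prefix_code_list_encode cylinder_def)

text \<open>Cylinders are also closed: a finite part of \<open>x\<close> already shows that it lies
  outside.\<close>

lemma eventually_clash_code:
  assumes "x \<notin> cylinder \<sigma>"
  shows "eventually (\<lambda>N. clash_code (list_encode \<sigma>) (list_encode (initial x N))) sequentially"
proof -
  obtain i where "i < length \<sigma>" "x i \<noteq> \<sigma> ! i" using assms by (auto simp: cylinder_def)
  then show ?thesis
    by (intro eventually_mono[OF eventually_ge_at_top[of "length \<sigma>"]])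
      (force simp: clash_code_list_encode)
qed

text \<open>The code \<open>0\<close> stands for the empty set, so that an enumeration may stay idle.\<close>

definition box :: "nat \<Rightarrow> (baire \<times> baire) set" where
  "box e = (case e of 0 \<Rightarrow> {} | Suc c \<Rightarrow>
    cylinder (list_decode (fst (prod_decode c))) \<times> cylinder (list_decode (snd (prod_decode c))))"

lemma box_0 [simp]: "box 0 = {}"
  by (simp add: box_def)

lemma box_Suc_code_pair [simp]: "box (Suc (code_pair (\<sigma>, \<tau>))) = cylinder \<sigma> \<times> cylinder \<tau>"
  by (simp add: box_def code_pair_def)

lemma code_pair_surj: obtains \<sigma> \<tau> where "c = code_pair (\<sigma>, \<tau>)"
proof
  show "c = code_pair (list_decode (fst (prod_decode c)), list_decode (snd (prod_decode c)))"
    by (simp add: code_pair_def)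
qed

lemma box_cases:
  obtains "e = 0" | \<sigma> \<tau> where "e = Suc (code_pair (\<sigma>, \<tau>))"
  by (metis code_pair_surj not0_implies_Suc)

text \<open>A decidable test for inclusion. Here \<open>e\<close> is a shifted code and may be idle,
  while \<open>c\<close> is a plain pair code, so its box is \<open>box (Suc c)\<close>.\<close>

definition inside :: "nat \<Rightarrow> nat \<Rightarrow> bool" where
  "inside e c \<longleftrightarrow> e \<noteq> 0 \<and>
    prefix_code (fst (prod_decode (e - 1))) (fst (prod_decode c)) \<and>
    prefix_code (snd (prod_decode (e - 1))) (snd (prod_decode c))"

definition apart :: "nat \<Rightarrow> nat \<Rightarrow> bool" where
  "apart e c \<longleftrightarrow> e = 0 \<or>
    clash_code (fst (prod_decode (e - 1))) (fst (prod_decode c)) \<or>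
    clash_code (snd (prod_decode (e - 1))) (snd (prod_decode c))"

lemma inside_subset: "inside e c \<Longrightarrow> box (Suc c) \<subseteq> box e"
  by (cases e rule: box_cases; cases c rule: code_pair_surj)
    (auto simp: inside_def code_pair_def box_def dest!: cylinder_prefix_code)

lemma apart_disjoint: "apart e c \<Longrightarrow> box (Suc c) \<inter> box e = {}"
  by (cases e rule: box_cases; cases c rule: code_pair_surj)
    (auto simp: apart_def code_pair_def box_def dest!: cylinder_clash_code)

lemma eventually_inside:
  "(x, y) \<in> box e \<Longrightarrow>
    eventually (\<lambda>N. inside e (code_pair (initial x N, initial y N))) sequentially"
  by (cases e rule: box_cases)
    (auto simp: inside_def code_pair_def box_def intro!: eventually_conj eventually_prefix_code)

text \<open>A point outside a box misses one of its factors, and a clash in that coordinate alone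
  separates the boxes.\<close>

lemma eventually_apart:
  assumes "(x, y) \<notin> box e"
  shows "eventually (\<lambda>N. apart e (code_pair (initial x N, initial y N))) sequentially"
proof (cases e rule: box_cases)
  case (2 \<sigma> \<tau>)
  then consider "x \<notin> cylinder \<sigma>" | "y \<notin> cylinder \<tau>" using assms by auto
  then show ?thesis
    by cases (auto simp: 2 apart_def code_pair_def
        intro: eventually_mono[OF eventually_clash_code])
qed (simp add: apart_def)

section \<open>The reduction property\<close>

text \<open>Unlike \<open>ce\<close>, idling enumerations cover the empty set without a case distinction.\<close>

lemma Sigma01_2_iff_enumeration:
  "Sigma01_2 S \<longleftrightarrow> (\<exists>e. computable e \<and> S = (\<Union>n. box (e n)))"
proof
  assume "Sigma01_2 S"
  then obtain A where A: "ce (code_pair ` A)"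
    and S: "S = (\<Union>(\<sigma>, \<tau>)\<in>A. cylinder \<sigma> \<times> cylinder \<tau>)"
    unfolding Sigma01_2_def by blast
  have S': "S = (\<Union>c\<in>code_pair ` A. box (Suc c))"
    unfolding S by (auto simp: split_beta)
  show "\<exists>e. computable e \<and> S = (\<Union>n. box (e n))"
  proof (cases "A = {}")
    case True
    have "computable (\<lambda>_. 0)" unfolding computable_iff_recursive by (rule recursive_const)
    with True S show ?thesis by (intro exI[of _ "\<lambda>_. 0"]) auto
  next
    case False
    then obtain h where h: "computable h" "code_pair ` A = range h"
      using A unfolding ce_def by auto
    have "computable (\<lambda>n. Suc (h n))"
      using h(1) unfolding computable_iff_recursive by (rule recursive_Suc)
    with h(2) S' show ?thesis by (intro exI[of _ "\<lambda>n. Suc (h n)"]) auto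
  qed
next
  assume "\<exists>e. computable e \<and> S = (\<Union>n. box (e n))"
  then obtain e where e: "computable e" and S: "S = (\<Union>n. box (e n))" by blast
  define C where "C = {c. Suc c \<in> range e}"
  have "ce C"
  proof (cases "C = {}")
    case False
    then obtain c where c: "c \<in> C" by blast
    \<comment> \<open>Idle stages repeat the fixed element \<open>c\<close>, which makes
      \<open>?h\<close> total without enlarging its range beyond \<open>C\<close>.\<close>
    let ?h = "\<lambda>n. if e n = 0 then c else e n - 1"
    have "computable ?h"
      unfolding computable_iff_recursive
      by (intro recursive_intros recursive_comp1[OF e]) auto
    moreover have "C = range ?h"
    proof
      show "C \<subseteq> range ?h"
      proof
        fix d assume "d \<in> C"
        then obtain n where "e n = Suc d" unfolding C_def by force
        then have "d = ?h n" by simp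
        then show "d \<in> range ?h" by (rule range_eqI)
      qed
      have "Suc (e n - 1) \<in> range e" if "e n \<noteq> 0" for n
        using that by (intro range_eqI[of _ _ n]) simp
      then show "range ?h \<subseteq> C" using c unfolding C_def by auto
    qed
    ultimately show ?thesis unfolding ce_def by blast
  qed (simp add: ce_def)
  moreover have "code_pair ` (code_pair -` C) = C"
    by (rule surj_image_vimage_eq) (metis code_pair_surj surj_def)
  moreover have "S = (\<Union>(\<sigma>, \<tau>)\<in>code_pair -` C. cylinder \<sigma> \<times> cylinder \<tau>)"
  proof (intro equalityI subsetI)
    fix p assume "p \<in> S"
    then obtain n where n: "p \<in> box (e n)" using S by blast
    then obtain \<sigma> \<tau> where en: "e n = Suc (code_pair (\<sigma>, \<tau>))"
      by (cases "e n" rule: box_cases) auto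
    then have "(\<sigma>, \<tau>) \<in> code_pair -` C" unfolding C_def by (simp add: image_iff) metis
    then show "p \<in> (\<Union>(\<sigma>, \<tau>)\<in>code_pair -` C. cylinder \<sigma> \<times> cylinder \<tau>)"
      using n en by auto
  next
    fix p assume "p \<in> (\<Union>(\<sigma>, \<tau>)\<in>code_pair -` C. cylinder \<sigma> \<times> cylinder \<tau>)"
    then obtain \<sigma> \<tau> where "Suc (code_pair (\<sigma>, \<tau>)) \<in> range e" "p \<in> cylinder \<sigma> \<times> cylinder \<tau>"
      unfolding C_def by auto
    then show "p \<in> S" unfolding S by (metis UN_iff box_Suc_code_pair rangeE UNIV_I)
  qed
  ultimately show "Sigma01_2 S" unfolding Sigma01_2_def by metis
qed

lemma Sigma01_2_Un:
  assumes "Sigma01_2 S" "Sigma01_2 T"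
  shows "Sigma01_2 (S \<union> T)"
proof -
  obtain a b where a: "computable a" and S: "S = (\<Union>n. box (a n))"
    and b: "computable b" and T: "T = (\<Union>n. box (b n))"
    using assms unfolding Sigma01_2_iff_enumeration by blast
  \<comment> \<open>The index \<open>k\<close> codes a tag and a stage: tag 0 selects
    \<open>a\<close>, any other tag selects \<open>b\<close>.\<close>
  let ?e = "\<lambda>k. if fst (prod_decode k) = 0 then a (snd (prod_decode k))
    else b (snd (prod_decode k))"
  have "computable ?e"
    unfolding computable_iff_recursive
    by (intro recursive_intros recursive_comp1[OF a] recursive_comp1[OF b]) auto
  moreover have "S \<union> T = (\<Union>k. box (?e k))"
  proof (intro equalityI subsetI)
    fix p assume "p \<in> S \<union> T"
    then consider n where "p \<in> box (?e (prod_encode (0, n)))"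
      | n where "p \<in> box (?e (prod_encode (1, n)))"
      unfolding S T by auto
    then show "p \<in> (\<Union>k. box (?e k))" by cases blast+
  qed (auto simp: S T split: if_splits)
  ultimately show ?thesis unfolding Sigma01_2_iff_enumeration by blast
qed

lemma Sigma01_2_Times_UNIV:
  assumes "Sigma01 S"
  shows "Sigma01_2 (S \<times> UNIV)"
proof -
  obtain A where A: "ce (list_encode ` A)" and S: "S = (\<Union>\<sigma>\<in>A. cylinder \<sigma>)"
    using assms unfolding Sigma01_def by blast
  \<comment> \<open>The empty list has code 0 and its cylinder is the whole space.\<close>
  have image: "code_pair ` (A \<times> {[]}) = (\<lambda>c. prod_encode (c, 0)) ` list_encode ` A"
    by (force simp: code_pair_def)
  have "ce (code_pair ` (A \<times> {[]}))"
  proof (cases "A = {}")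
    case False
    then obtain h where h: "computable h" "list_encode ` A = range h"
      using A unfolding ce_def by auto
    have "computable (\<lambda>n. prod_encode (h n, 0))"
      unfolding computable_iff_recursive
      by (intro recursive_intros recursive_comp1[OF h(1)]) auto
    moreover have "code_pair ` (A \<times> {[]}) = range (\<lambda>n. prod_encode (h n, 0))"
      unfolding image h(2) by (simp add: image_image)
    ultimately show ?thesis unfolding ce_def by blast
  qed (simp add: ce_def)
  moreover have "S \<times> UNIV = (\<Union>(\<sigma>, \<tau>)\<in>A \<times> {[]}. cylinder \<sigma> \<times> cylinder \<tau>)"
    unfolding S by (auto simp: cylinder_def)
  ultimately show ?thesis unfolding Sigma01_2_def by blast
qed

text \<open>For each \<open>n\<close> only finitely many clopen boxes are removed from
  \<open>box (a n)\<close>, so an open set remains; decidable tests on codes enumerate it. The bound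
  \<open>r\<close> sets which side wins ties.\<close>

lemma Sigma01_2_enumerated_before:
  assumes a: "computable a" and b: "computable b" and r: "computable r"
  shows "Sigma01_2 {p. \<exists>n. p \<in> box (a n) \<and> (\<forall>m<r n. p \<notin> box (b m))}" (is "Sigma01_2 ?S")
proof -
  let ?D = "\<lambda>n c. inside (a n) c \<and> (\<forall>m<r n. apart (b m) c)"
  \<comment> \<open>The index \<open>k\<close> codes a stage \<open>n\<close> and a candidate box
    \<open>c\<close>; a candidate failing the test yields the idle code 0.\<close>
  let ?e = "\<lambda>k. if ?D (fst (prod_decode k)) (snd (prod_decode k))
    then Suc (snd (prod_decode k)) else 0"
  have "decidable 1 (\<lambda>xs. \<forall>m<r (fst (prod_decode (xs ! 0))).
      (\<lambda>zs. apart (b (zs ! 0)) (snd (prod_decode (zs ! 1)))) (m # xs))"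
    unfolding apart_def
    by (rule decidable_all_less;
        intro recursive_intros recursive_comp1[OF b] recursive_comp1[OF r]) auto
  then have "decidable 1 (\<lambda>xs. \<forall>m<r (fst (prod_decode (xs ! 0))).
      apart (b m) (snd (prod_decode (xs ! 0))))" by simp
  then have "computable ?e"
    unfolding computable_iff_recursive inside_def
    by (intro recursive_intros recursive_comp1[OF a]) auto
  moreover have "?S = (\<Union>k. box (?e k))"
  proof (intro equalityI subsetI)
    fix p assume "p \<in> ?S"
    then obtain x y n where p: "p = (x, y)" and n: "(x, y) \<in> box (a n)"
      and m: "\<And>m. m < r n \<Longrightarrow> (x, y) \<notin> box (b m)" by (cases p) auto
    let ?c = "\<lambda>N. code_pair (initial x N, initial y N)"
    \<comment> \<open>The boxes \<open>?c N\<close> shrink to the point, so the finitely many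
      separations and the inclusion in \<open>box (a n)\<close> hold for a common
      \<open>N\<close>.\<close>
    have "eventually (\<lambda>N. \<forall>m\<in>{..<r n}. apart (b m) (?c N)) sequentially"
      by (rule eventually_ball_finite) (simp_all add: eventually_apart m)
    then have "eventually (\<lambda>N. ?D n (?c N)) sequentially"
      using eventually_inside[OF n] by eventually_elim auto
    then obtain N where "?D n (?c N)" unfolding eventually_sequentially by blast
    then have "?e (prod_encode (n, ?c N)) = Suc (?c N)" by simp
    moreover have "p \<in> box (Suc (?c N))" by (simp add: p cylinder_def)
    ultimately have "p \<in> box (?e (prod_encode (n, ?c N)))" by (simp only:)
    then show "p \<in> (\<Union>k. box (?e k))" by (rule UN_I[OF UNIV_I])
  next
    fix p assume "p \<in> (\<Union>k. box (?e k))"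
    then obtain n c where p: "p \<in> box (Suc c)" and D: "?D n c" by (auto split: if_splits)
    then show "p \<in> ?S" using inside_subset apart_disjoint by blast
  qed
  ultimately show ?thesis unfolding Sigma01_2_iff_enumeration by blast
qed

lemma Sigma01_2_reduction:
  assumes "Sigma01_2 S" "Sigma01_2 T"
  obtains S' T' where "Sigma01_2 S'" "Sigma01_2 T'" "S' \<subseteq> S" "T' \<subseteq> T"
    "S' \<union> T' = S \<union> T" "S' \<inter> T' = {}"
proof -
  obtain a b where a: "computable a" and S: "S = (\<Union>n. box (a n))"
    and b: "computable b" and T: "T = (\<Union>n. box (b n))"
    using assms unfolding Sigma01_2_iff_enumeration by blast
  \<comment> \<open>The bounds \<open>n\<close> and \<open>Suc n\<close> award a simultaneous
    capture to the first set, so ties are neither lost nor counted twice.\<close>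
  let ?S = "{p. \<exists>n. p \<in> box (a n) \<and> (\<forall>m<n. p \<notin> box (b m))}"
  let ?T = "{p. \<exists>n. p \<in> box (b n) \<and> (\<forall>m<Suc n. p \<notin> box (a m))}"
  show ?thesis
  proof
    show "Sigma01_2 ?S"
      by (rule Sigma01_2_enumerated_before[OF a b])
        (auto simp: computable_iff_recursive intro!: recursive_intros)
    show "Sigma01_2 ?T"
      by (rule Sigma01_2_enumerated_before[OF b a])
        (auto simp: computable_iff_recursive intro!: recursive_intros)
    show "?S \<subseteq> S" "?T \<subseteq> T" unfolding S T by auto
    show "?S \<inter> ?T = {}" by (auto simp: less_Suc_eq_le) (metis leI)
    show "?S \<union> ?T = S \<union> T"
    proof (intro equalityI subsetI)
      fix p assume "p \<in> S \<union> T"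
      then have "\<exists>n. p \<in> box (a n) \<or> p \<in> box (b n)" unfolding S T by auto
      \<comment> \<open>At the least stage capturing \<open>p\<close> in either enumeration,
        \<open>p\<close> goes to \<open>?S\<close> if \<open>a\<close> captures it there, and
        otherwise to \<open>?T\<close>.\<close>
      then obtain n where "p \<in> box (a n) \<or> p \<in> box (b n)"
        and "\<And>m. m < n \<Longrightarrow> \<not> (p \<in> box (a m) \<or> p \<in> box (b m))"
        using exists_least_iff[of "\<lambda>n. p \<in> box (a n) \<or> p \<in> box (b n)"] by blast
      then show "p \<in> ?S \<union> ?T" unfolding less_Suc_eq by blast
    qed (auto simp: S T)
  qed
qed

theorem theorem17:
  fixes f :: "nat \<Rightarrow> nat"
  assumes "Pi01_singleton f"
  shows "strongly_relativizes_Delta01 f"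
  unfolding strongly_relativizes_Delta01_def
proof (intro allI impI)
  fix P assume "Delta01_in f P"
  then obtain U V where U: "Sigma01_2 U" "P = fsection U f"
    and V: "Sigma01_2 V" "- P = fsection V f"
    unfolding Delta01_in_def by blast
  \<comment> \<open>This is where the singleton hypothesis enters: all points off the line over
    \<open>f\<close> can be added to \<open>V\<close> effectively.\<close>
  have "Sigma01_2 ((- {f}) \<times> UNIV)"
    using assms unfolding Pi01_singleton_def Pi01_def by (rule Sigma01_2_Times_UNIV)
  with V(1) have "Sigma01_2 (V \<union> (- {f}) \<times> UNIV)" by (rule Sigma01_2_Un)
  with U(1) obtain Q R where Q: "Sigma01_2 Q" "Q \<subseteq> U"
    and R: "Sigma01_2 R" "R \<subseteq> V \<union> (- {f}) \<times> UNIV"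
    and cover: "Q \<union> R = U \<union> (V \<union> (- {f}) \<times> UNIV)" and disjoint: "Q \<inter> R = {}"
    by (rule Sigma01_2_reduction)
  have P_iff: "g \<in> P \<longleftrightarrow> (f, g) \<in> U" "g \<notin> P \<longleftrightarrow> (f, g) \<in> V" for g
    using U(2) V(2) by (auto simp: fsection_def)
  \<comment> \<open>Over \<open>f\<close> the sections \<open>P\<close> and \<open>- P\<close>
    cover; elsewhere the added set does.\<close>
  have "(x, g) \<in> Q \<union> R" for x g
    unfolding cover using P_iff[of g] by (cases "x = f") auto
  then have "- Q = R" using disjoint by auto
  with Q(1) R(1) have "Delta01_2 Q" by (simp add: Delta01_2_def Pi01_2_def)
  moreover have "P = fsection Q f"
  proof (intro equalityI subsetI)
    fix g assume "g \<in> P"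
    \<comment> \<open>Over \<open>f\<close> the added set is empty, so \<open>R\<close> is confined
      to \<open>V\<close>, whose section is \<open>- P\<close>.\<close>
    then have "(f, g) \<notin> R" using P_iff[of g] R(2) by auto
    with \<open>- Q = R\<close> show "g \<in> fsection Q f" by (auto simp: fsection_def)
  next
    fix g assume "g \<in> fsection Q f"
    then show "g \<in> P" using Q(2) P_iff(1) by (auto simp: fsection_def)
  qed
  ultimately show "\<exists>Q. Delta01_2 Q \<and> P = fsection Q f" by blast
qed

end
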